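(* Consider the star-game. The value of the game on a $2\times m$ grid is $\lceil m/2\rceil$, regardless of which player has which role (that is, both when Maximizer initiates and Minimizer responds, and when Minimizer initiates and Maximizer responds).
   Context: $P_3$ is the path on three vertices; copies of $P_3$ in a graph are subgraphs, not necessarily induced. The $2\times m$ grid is the Cartesian product of the path on $2$ vertices and the path on $m$ vertices ($2$ rows and $m$ columns, with vertices adjacent when they are horizontally or vertically consecutive). The star-game on a graph $G$ is played by two players, Maximizer and Minimizer; throughout the game one of them is the initiator and the other is the responder. In each round, the initiator chooses a vertex $v$ of the current graph such that the current graph contains at least one copy of $P_3$ with $v$ as its center vertex (degree-2 vertex of the path); the responder then chooses one copy of $P_3$ in the current graph with $v$ as its center; the three vertices of that copy are removed, and the next round is played on the subgraph induced by the remaining vertices. The game ends when the remaining graph contains no copy of $P_3$. Maximizer tries to maximize, and Minimizer tries to minimize, the number of copies of $P_3$ taken. The value of the game is the number of copies taken under optimal play by both players.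
   Formalization: The formal statement assumes m ≥ 2: for m = 1 the 2×1 grid is a single edge with no copy of P_3, so the value of the game is 0 and not ⌈1/2⌉ = 1. *)

theory Defs
  imports Complex_Main
begin

text \<open>Undirected simple graphs; an edge is the two-element set of its endpoints.\<close>

record 'a sgraph =
  verts :: "'a set"
  edges :: "'a set set"

definition path_graph :: "nat \<Rightarrow> nat sgraph" where
  "path_graph n = \<lparr>verts = {..<n}, edges = {{i, Suc i} | i. Suc i < n}\<rparr>"

definition cartesian_product :: "'a sgraph \<Rightarrow> 'b sgraph \<Rightarrow> ('a \<times> 'b) sgraph" where
  "cartesian_product G H =
     \<lparr>verts = verts G \<times> verts H,
      edges = {{(a, x), (a, y)} | a x y. a \<in> verts G \<and> {x, y} \<in> edges H}
            \<union> {{(a, x), (b, x)} | a b x. {a, b} \<in> edges G \<and> x \<in> verts H}\<rparr>"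

definition grid :: "nat \<Rightarrow> nat \<Rightarrow> (nat \<times> nat) sgraph" where
  "grid n m = cartesian_product (path_graph n) (path_graph m)"

definition induced_subgraph :: "'a sgraph \<Rightarrow> 'a set \<Rightarrow> 'a sgraph" where
  "induced_subgraph G S = \<lparr>verts = S, edges = {e \<in> edges G. e \<subseteq> S}\<rparr>"

definition subgraph :: "'a sgraph \<Rightarrow> 'a sgraph \<Rightarrow> bool" where
  "subgraph H G \<longleftrightarrow> verts H \<subseteq> verts G \<and> edges H \<subseteq> edges G"

text \<open>The (not necessarily induced) copies of \<open>P\<^sub>3\<close> in \<open>G\<close> with center \<open>v\<close>.\<close>

definition P3_copies_at :: "'a sgraph \<Rightarrow> 'a \<Rightarrow> 'a sgraph set" where
  "P3_copies_at G v =
     {C. subgraph C G \<and>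
         (\<exists>a b. a \<noteq> v \<and> b \<noteq> v \<and> a \<noteq> b \<and>
                C = \<lparr>verts = {a, v, b}, edges = {{a, v}, {v, b}}\<rparr>)}"

definition P3_centers :: "'a sgraph \<Rightarrow> 'a set" where
  "P3_centers G = {v \<in> verts G. P3_copies_at G v \<noteq> {}}"

definition remove_copy :: "'a sgraph \<Rightarrow> 'a sgraph \<Rightarrow> 'a sgraph" where
  "remove_copy G C = induced_subgraph G (verts G - verts C)"

datatype player = Maximizer | Minimizer

fun opponent :: "player \<Rightarrow> player" where
  "opponent Maximizer = Minimizer"
| "opponent Minimizer = Maximizer"

fun best :: "player \<Rightarrow> nat set \<Rightarrow> nat" where
  "best Maximizer X = Max X"
| "best Minimizer X = Min X"

text \<open>
  The value under optimal play, by backward induction; \<open>p\<close> is the initiator in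
  every round. \<open>Max\<close> and \<open>Min\<close> are only taken over finite nonempty sets. For an
  infinite vertex set the value is the dummy \<open>0\<close>.
\<close>

function star_game_value :: "player \<Rightarrow> 'a sgraph \<Rightarrow> nat" where
  "star_game_value p G =
     (if finite (verts G) \<and> P3_centers G \<noteq> {} then
        best p
          ((\<lambda>v. best (opponent p)
                  ((\<lambda>C. Suc (star_game_value p (remove_copy G C))) ` P3_copies_at G v))
           ` P3_centers G)
      else 0)"
  by pat_completeness auto
termination
proof (relation "measure (\<lambda>(p, G). card (verts G))", goal_cases)
  case 1
  show ?case by simp
next
  case (2 p G v C)
  then have "v \<in> verts G" "v \<in> verts C"
    by (auto simp: P3_centers_def P3_copies_at_def)
  with 2 show ?case
    by (auto simp: remove_copy_def induced_subgraph_def intro!: psubset_card_mono)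
qed

declare star_game_value.simps [simp del]

end

theory Submission
  imports Defs
begin

text \<open>
  On the ladder either side alone can force the game to last exactly
  \<open>\<lceil>m/2\<rceil>\<close> rounds. So the goals of the two players do not matter: whoever initiates,
  each player can use the forcing strategy of that role, which gives both bounds on the
  value (\<open>star_game_value_forced\<close>).

  The initiator never leaves the responder a choice. Naming the corner in row 0 of the
  first full column has only one possible answer, the two neighbours of the corner. This
  uses up that column and leaves from the next one just the vertex in row 1. The row-0
  vertex of the following full column does not see the left-over vertex, so it is a corner
  again. Every round takes two columns; if one full column remains in the end, the vertex
  left over to its left completes a last copy (\<open>initiator_forces_combed_ladder\<close>).

  The responder cuts the ladder into \<open>2 \<times> 2\<close> blocks, except that the leftmost block is
  \<open>2 \<times> 3\<close> when \<open>m\<close> is odd, and answers inside the block of the center whenever that block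
  contains a copy with this center. A \<open>2 \<times> 2\<close> block is then worth one round and a
  \<open>2 \<times> 3\<close> block two: its six vertices can be used up as two copies, whichever center is
  named first. The answer can be forced to leave the block only if the block has been
  reduced to a three-vertex path and the center is an end of this path. In that case the
  path is spoiled, having paid for the round, and the neighbouring block loses one vertex.
  The strategy keeps to the condition that the block to the left of such a path is used up,
  with at most one vertex remaining. So the loss costs nothing on the left, and on the right
  it turns an untouched \<open>2 \<times> 2\<close> block into a three-vertex path that is still worth one round
  and has a used-up block to its left (\<open>balanced_reply\<close>). Counting
  \<open>\<lfloor>size / 3\<rfloor>\<close> over all blocks therefore gives exactly the number of rounds to come.
\<close>

section \<open>Forcing the length of the game\<close>

text \<open>
  Positions of the game are vertex sets \<open>S\<close> of a fixed graph \<open>G\<close>; a copy of \<open>P\<^sub>3\<close> is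
  recorded by its center and the two leaves.
\<close>

definition cherry :: "'a sgraph \<Rightarrow> 'a set \<Rightarrow> 'a \<Rightarrow> 'a \<Rightarrow> 'a \<Rightarrow> bool" where
  "cherry G S a v b \<longleftrightarrow> {a, v, b} \<subseteq> S \<and> a \<noteq> v \<and> b \<noteq> v \<and> a \<noteq> b
     \<and> {v, a} \<in> edges G \<and> {v, b} \<in> edges G"

text \<open>
  Asking for exactly \<open>n\<close> rounds makes these notions independent of whether the forcing side
  wants a long or a short game.
\<close>

primrec initiator_forces :: "'a sgraph \<Rightarrow> nat \<Rightarrow> 'a set \<Rightarrow> bool" where
  "initiator_forces G 0 S \<longleftrightarrow> (\<forall>a v b. \<not> cherry G S a v b)"
| "initiator_forces G (Suc n) S \<longleftrightarrow>
     (\<exists>v. (\<exists>a b. cherry G S a v b) \<and>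
          (\<forall>a b. cherry G S a v b \<longrightarrow> initiator_forces G n (S - {a, v, b})))"

primrec responder_forces :: "'a sgraph \<Rightarrow> nat \<Rightarrow> 'a set \<Rightarrow> bool" where
  "responder_forces G 0 S \<longleftrightarrow> (\<forall>a v b. \<not> cherry G S a v b)"
| "responder_forces G (Suc n) S \<longleftrightarrow>
     (\<exists>a v b. cherry G S a v b) \<and>
     (\<forall>v. (\<exists>a b. cherry G S a v b) \<longrightarrow>
          (\<exists>a b. cherry G S a v b \<and> responder_forces G n (S - {a, v, b})))"

text \<open>
  The order in which a player ranks the outcomes; with it, one argument covers the maximum
  taken by one player and the minimum taken by the other.
\<close>

fun weakly_prefers :: "player \<Rightarrow> nat \<Rightarrow> nat \<Rightarrow> bool" where
  "weakly_prefers Maximizer x y \<longleftrightarrow> y \<le> x"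
| "weakly_prefers Minimizer x y \<longleftrightarrow> x \<le> y"

lemma weakly_prefers_opponent: "weakly_prefers (opponent p) x y \<longleftrightarrow> weakly_prefers p y x"
  by (cases p) auto

lemma weakly_prefers_antisym: "weakly_prefers p x y \<Longrightarrow> weakly_prefers p y x \<Longrightarrow> x = y"
  by (cases p) auto

lemma weakly_prefers_Suc: "weakly_prefers p (Suc x) (Suc y) \<longleftrightarrow> weakly_prefers p x y"
  by (cases p) auto

lemma weakly_prefers_refl: "weakly_prefers p x x"
  by (cases p) auto

lemma best_at_least:
  assumes "finite X" "x \<in> X" "weakly_prefers p x y"
  shows "weakly_prefers p (best p X) y"
proof (cases p)
  case Maximizer
  then show ?thesis using assms Max_ge[OF assms(1,2)] by (simp del: Max_ge)
next
  case Minimizer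
  then show ?thesis using assms Min_le[OF assms(1,2)] by (simp del: Min_le)
qed

lemma best_at_most:
  assumes "finite X" "X \<noteq> {}" "\<And>x. x \<in> X \<Longrightarrow> weakly_prefers p y x"
  shows "weakly_prefers p y (best p X)"
  using assms by (cases p) auto

definition cherry_graph :: "'a \<Rightarrow> 'a \<Rightarrow> 'a \<Rightarrow> 'a sgraph" where
  "cherry_graph a v b = \<lparr>verts = {a, v, b}, edges = {{a, v}, {v, b}}\<rparr>"

lemma P3_copies_at_induced:
  "P3_copies_at (induced_subgraph G S) v = {cherry_graph a v b | a b. cherry G S a v b}"
proof -
  have "cherry G S a v b \<longleftrightarrow> a \<noteq> v \<and> b \<noteq> v \<and> a \<noteq> b \<and>
          subgraph (cherry_graph a v b) (induced_subgraph G S)" for a b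
    by (auto simp: cherry_def cherry_graph_def subgraph_def induced_subgraph_def insert_commute)
  then show ?thesis
    unfolding P3_copies_at_def cherry_graph_def[symmetric] by blast
qed

lemma P3_centers_induced:
  "P3_centers (induced_subgraph G S) = {v. \<exists>a b. cherry G S a v b}"
  unfolding P3_centers_def P3_copies_at_induced
  by (auto simp: induced_subgraph_def cherry_def)

lemma remove_cherry_graph:
  "remove_copy (induced_subgraph G S) (cherry_graph a v b) = induced_subgraph G (S - {a, v, b})"
  by (auto simp: remove_copy_def induced_subgraph_def cherry_graph_def)

definition value_after_center :: "player \<Rightarrow> 'a sgraph \<Rightarrow> 'a set \<Rightarrow> 'a \<Rightarrow> nat" where
  "value_after_center p G S v =
     best (opponent p) {Suc (star_game_value p (induced_subgraph G (S - {a, v, b}))) | a b.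
                          cherry G S a v b}"

lemma star_game_value_induced:
  assumes "finite S" "\<exists>a v b. cherry G S a v b"
  shows "star_game_value p (induced_subgraph G S) =
           best p (value_after_center p G S ` {v. \<exists>a b. cherry G S a v b})"
proof -
  have image: "h ` {cherry_graph a v b | a b. cherry G S a v b}
               = {h (cherry_graph a v b) | a b. cherry G S a v b}" for h :: "'a sgraph \<Rightarrow> nat" and v
    by blast
  have "(\<lambda>C. Suc (star_game_value p (remove_copy (induced_subgraph G S) C)))
          ` P3_copies_at (induced_subgraph G S) v
        = {Suc (star_game_value p (induced_subgraph G (S - {a, v, b}))) | a b. cherry G S a v b}"
    for v
    unfolding P3_copies_at_induced image remove_cherry_graph ..
  moreover have "finite (verts (induced_subgraph G S)) \<and> P3_centers (induced_subgraph G S) \<noteq> {}"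
    using assms by (auto simp: P3_centers_induced) (simp add: induced_subgraph_def)
  ultimately show ?thesis
    by (subst star_game_value.simps) (simp add: P3_centers_induced value_after_center_def[abs_def])
qed

lemma star_game_value_no_cherry:
  assumes "\<And>a v b. \<not> cherry G S a v b"
  shows "star_game_value p (induced_subgraph G S) = 0"
  using assms by (subst star_game_value.simps) (simp add: P3_centers_induced)

lemma finite_replies:
  assumes "finite S"
  shows "finite {f a b | a b. cherry G S a v b}"
proof -
  have "{f a b | a b. cherry G S a v b} \<subseteq> (\<lambda>(a, b). f a b) ` (S \<times> S)"
    by (auto simp: cherry_def)
  then show ?thesis
    using assms by (meson finite_SigmaI finite_imageI finite_subset)
qed

lemma finite_centers:
  assumes "finite S"
  shows "finite {v. \<exists>a b. cherry G S a v b}"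
  by (rule finite_subset[OF _ assms]) (auto simp: cherry_def)

text \<open>
  A player who can force \<open>n\<close> rounds gets an outcome at least as good as \<open>n\<close>. Here the
  initiator \<open>p\<close> is that player.
\<close>

lemma initiator_forces_value:
  assumes "finite S" "initiator_forces G n S"
  shows "weakly_prefers p (star_game_value p (induced_subgraph G S)) n"
  using assms
proof (induction n arbitrary: S)
  case 0
  then show ?case by (simp add: star_game_value_no_cherry weakly_prefers_refl)
next
  case (Suc n)
  then obtain v where ex: "\<exists>a b. cherry G S a v b"
    and all: "\<And>a b. cherry G S a v b \<Longrightarrow> initiator_forces G n (S - {a, v, b})"
    by auto
  have "weakly_prefers (opponent p) (Suc n) (value_after_center p G S v)"
    unfolding value_after_center_def
    using ex Suc.IH[OF _ all] Suc.prems(1)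
    by (intro best_at_most finite_replies)
       (auto simp: weakly_prefers_opponent weakly_prefers_Suc)
  then have "weakly_prefers p (value_after_center p G S v) (Suc n)"
    by (simp add: weakly_prefers_opponent)
  moreover have "star_game_value p (induced_subgraph G S) =
      best p (value_after_center p G S ` {v. \<exists>a b. cherry G S a v b})"
    using ex Suc.prems(1) by (intro star_game_value_induced) auto
  ultimately show ?case
    using ex finite_centers[OF Suc.prems(1)] by (auto intro!: best_at_least)
qed

lemma responder_forces_value:
  assumes "finite S" "responder_forces G n S"
  shows "weakly_prefers (opponent p) (star_game_value p (induced_subgraph G S)) n"
  using assms
proof (induction n arbitrary: S)
  case 0
  then show ?case by (simp add: star_game_value_no_cherry weakly_prefers_refl)
next
  case (Suc n)
  have "weakly_prefers p (Suc n) (value_after_center p G S v)" if "\<exists>a b. cherry G S a v b" for v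
  proof -
    obtain a b where ab: "cherry G S a v b" "responder_forces G n (S - {a, v, b})"
      using Suc.prems(2) \<open>\<exists>a b. cherry G S a v b\<close> unfolding responder_forces.simps by blast
    have "weakly_prefers (opponent p) (value_after_center p G S v) (Suc n)"
      unfolding value_after_center_def
      by (rule best_at_least
            [where x = "Suc (star_game_value p (induced_subgraph G (S - {a, v, b})))"])
         (use ab Suc.IH[OF _ ab(2)] Suc.prems(1) in
           \<open>auto simp: weakly_prefers_Suc intro!: finite_replies\<close>)
    then show ?thesis by (simp add: weakly_prefers_opponent)
  qed
  moreover have ex: "\<exists>a v b. cherry G S a v b"
    using Suc.prems(2) by simp
  ultimately have "weakly_prefers p (Suc n) (star_game_value p (induced_subgraph G S))"
    unfolding star_game_value_induced[OF Suc.prems(1) ex]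
    using finite_centers[OF Suc.prems(1)] by (intro best_at_most) auto
  then show ?case by (simp add: weakly_prefers_opponent)
qed

text \<open>
  The initiator gets at least as good as \<open>n\<close>, and so does the responder, whose preferences
  are opposite. This leaves only the value \<open>n\<close>, whatever the role of the maximizing player.
\<close>

lemma star_game_value_forced:
  assumes "finite S" "initiator_forces G n S" "responder_forces G n S"
  shows "star_game_value p (induced_subgraph G S) = n"
  using initiator_forces_value[OF assms(1,2)] responder_forces_value[OF assms(1,3)]
  by (metis weakly_prefers_antisym weakly_prefers_opponent)


section \<open>A responder strategy for graphs cut into a chain of blocks\<close>

definition is_cherry :: "'a sgraph \<Rightarrow> 'a set \<Rightarrow> bool" where
  "is_cherry G X \<longleftrightarrow> (\<exists>a v b. X = {a, v, b} \<and> cherry G X a v b)"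

text \<open>
  The properties of a \<open>2 \<times> 2\<close> and of a \<open>2 \<times> 3\<close> grid that the strategy relies on.
  In a single block, any answer to any center leaves one vertex, and the loss of any vertex
  leaves a copy. In a double block, every center has an answer after which the rest is a copy.
\<close>

definition single_block :: "'a sgraph \<Rightarrow> 'a set \<Rightarrow> bool" where
  "single_block G X \<longleftrightarrow> card X = 4 \<and> (\<forall>v\<in>X. \<exists>a b. cherry G X a v b)
     \<and> (\<forall>w\<in>X. is_cherry G (X - {w}))"

definition double_block :: "'a sgraph \<Rightarrow> 'a set \<Rightarrow> bool" where
  "double_block G X \<longleftrightarrow> card X = 6
     \<and> (\<forall>v\<in>X. \<exists>a b. cherry G X a v b \<and> is_cherry G (X - {a, v, b}))"

lemma cherry_mono: "cherry G S a v b \<Longrightarrow> S \<subseteq> T \<Longrightarrow> cherry G T a v b"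
  by (auto simp: cherry_def)

lemma card_cherry: "cherry G S a v b \<Longrightarrow> card {a, v, b} = 3"
  by (auto simp: cherry_def card_insert_if)

lemma card_is_cherry: "is_cherry G X \<Longrightarrow> card X = 3"
  using card_cherry unfolding is_cherry_def by metis

text \<open>
  Blocks are numbered from left to right. Since no vertex has two neighbours outside its own
  block, a block with one remaining vertex contains no center. Only block 0 may be a double
  block, so every block that can lose a vertex to a path on its left is single.
\<close>

locale block_chain =
  fixes G :: "'a sgraph" and block :: "'a \<Rightarrow> nat"
  assumes finite_verts: "finite (verts G)"
    and block_step: "{v, a} \<in> edges G \<Longrightarrow> block a \<le> Suc (block v)"
    and one_outside: "\<lbrakk>{v, a} \<in> edges G; {v, b} \<in> edges G; block a \<noteq> block v; block b \<noteq> block v\<rbrakk>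
          \<Longrightarrow> a = b"
    and block_shape: "i \<in> block ` verts G \<Longrightarrow>
          single_block G {v \<in> verts G. block v = i} \<or>
          i = 0 \<and> double_block G {v \<in> verts G. block v = i}"
begin

definition part :: "'a set \<Rightarrow> nat \<Rightarrow> 'a set" where
  "part S i = {v \<in> S. block v = i}"

text \<open>
  Each block is used up, untouched, or reduced to a path with a used-up block to its left.
  The last condition is what makes a path spoiled by a center at its end harmless: of
  two adjacent paths, the one on the left could take a vertex from the one on the right and
  both would be lost in a single round.
\<close>

definition balanced :: "'a set \<Rightarrow> bool" where
  "balanced S \<longleftrightarrow> S \<subseteq> verts G \<and>
     (\<forall>i. card (part S i) \<le> 1 \<or> part S i = part (verts G) i \<or>
          is_cherry G (part S i) \<and> (\<forall>j. i = Suc j \<longrightarrow> card (part S j) \<le> 1))"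

definition weight :: "'a set \<Rightarrow> nat" where
  "weight S = (\<Sum>i\<in>block ` verts G. card (part S i) div 3)"

lemma finite_part: "S \<subseteq> verts G \<Longrightarrow> finite (part S i)"
  unfolding part_def using finite_verts finite_subset by fastforce

lemma part_mono: "S \<subseteq> T \<Longrightarrow> part S i \<subseteq> part T i"
  by (auto simp: part_def)

lemma part_diff: "part (S - T) i = part S i - T"
  by (auto simp: part_def)

lemma part_subset: "part S i \<subseteq> S"
  by (auto simp: part_def)

text \<open>Nonemptiness matters because the untouched part of an index beyond the last block is empty.\<close>

lemma untouched_part:
  assumes "part (verts G) i \<noteq> {}"
  shows "single_block G (part (verts G) i) \<or> i = 0 \<and> double_block G (part (verts G) i)"
  using block_shape[of i] assms unfolding part_def by auto

lemma weight_drops: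
  assumes "i \<in> block ` verts G"
    and "card (part S i) div 3 = Suc (card (part T i) div 3)"
    and "\<And>j. j \<noteq> i \<Longrightarrow> card (part T j) div 3 = card (part S j) div 3"
  shows "weight S = Suc (weight T)"
proof -
  have fin: "finite (block ` verts G)"
    using finite_verts by simp
  have "(\<Sum>j\<in>block ` verts G - {i}. card (part T j) div 3)
        = (\<Sum>j\<in>block ` verts G - {i}. card (part S j) div 3)"
    by (rule sum.cong) (use assms(3) in auto)
  then show ?thesis
    unfolding weight_def sum.remove[OF fin assms(1)] using assms(2) by simp
qed

text \<open>
  All other blocks keep their vertices, so only the new state of block \<open>i\<close> has to be examined.
  A path may remain there only if \<open>i = 0\<close>, as a path needs a used-up block to its left.
\<close>

lemma reply_inside_block:
  assumes bal: "balanced S"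
    and ch: "cherry G (part S i) a v b"
    and rest: "card (part S i - {a, v, b}) \<le> 1 \<or> i = 0 \<and> is_cherry G (part S i - {a, v, b})"
  shows "balanced (S - {a, v, b}) \<and> weight S = Suc (weight (S - {a, v, b}))"
proof
  let ?T = "S - {a, v, b}"
  have SV: "S \<subseteq> verts G"
    using bal by (simp add: balanced_def)
  have sub: "{a, v, b} \<subseteq> part S i"
    using ch by (simp add: cherry_def)
  have same: "part ?T j = part S j" if "j \<noteq> i" for j
    using sub that by (auto simp: part_def)
  have mono: "card (part ?T j) \<le> card (part S j)" for j
    by (intro card_mono finite_part SV part_mono) auto
  show "balanced ?T"
    unfolding balanced_def
  proof (intro conjI allI)
    show "?T \<subseteq> verts G" using SV by auto
    fix j
    show "card (part ?T j) \<le> 1 \<or> part ?T j = part (verts G) j \<or>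
          is_cherry G (part ?T j) \<and> (\<forall>l. j = Suc l \<longrightarrow> card (part ?T l) \<le> 1)"
    proof (cases "j = i")
      case True
      then show ?thesis using rest by (auto simp: part_diff)
    next
      case False
      have "card (part S j) \<le> 1 \<or> part S j = part (verts G) j \<or>
          is_cherry G (part S j) \<and> (\<forall>l. j = Suc l \<longrightarrow> card (part S l) \<le> 1)"
        using bal unfolding balanced_def by blast
      then show ?thesis
        unfolding same[OF False] using mono le_trans by blast
    qed
  qed
  have "card (part ?T i) = card (part S i) - 3"
    using card_Diff_subset[OF _ sub] card_cherry[OF ch] by (simp add: part_diff)
  moreover have "3 \<le> card (part S i)"
    using card_mono[OF finite_part[OF SV] sub] card_cherry[OF ch] by simp
  ultimately have "card (part S i) div 3 = Suc (card (part ?T i) div 3)"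
    by presburger
  moreover have "i \<in> block ` verts G"
    using sub SV by (auto simp: part_def)
  ultimately show "weight S = Suc (weight ?T)"
    by (intro weight_drops[of i]) (simp_all add: same)
qed

text \<open>
  Here \<open>v\<close> is an end of the path in block \<open>i\<close>, \<open>c\<close> its neighbour on the path and \<open>w\<close> a
  neighbour in another block \<open>k\<close>. Block \<open>i\<close> keeps one vertex, which accounts for the round.
  Block \<open>k\<close> loses \<open>w\<close> but no worth: it was used up already, or it lies to the right and was
  untouched, and then it goes from four vertices to a path whose left neighbour \<open>i\<close> is now
  used up. It cannot have been a path, because its left neighbour was not used up.
\<close>

lemma reply_across_blocks:
  assumes bal: "balanced S"
    and path: "is_cherry G (part S i)"
    and prev: "\<And>j. i = Suc j \<Longrightarrow> card (part S j) \<le> 1"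
    and ch: "cherry G S c v w"
    and inside: "block v = i" "block c = i" and outside: "block w \<noteq> i"
  shows "balanced (S - {c, v, w}) \<and> weight S = Suc (weight (S - {c, v, w}))"
proof
  let ?T = "S - {c, v, w}"
  have SV: "S \<subseteq> verts G"
    using bal by (simp add: balanced_def)
  have cvw: "c \<in> S" "v \<in> S" "w \<in> S" "c \<noteq> v" "{v, w} \<in> edges G"
    using ch by (auto simp: cherry_def)
  define k where "k = block w"
  have k: "k \<noteq> i" "w \<in> part S k"
    using outside cvw by (auto simp: k_def part_def)
  have Ti: "part ?T i = part S i - {c, v}"
    using outside by (auto simp: part_def)
  have cards_i: "card (part S i) = 3" "card (part ?T i) = 1"
  proof -
    show "card (part S i) = 3"
      using path by (rule card_is_cherry)
    moreover have "{c, v} \<subseteq> part S i"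
      using cvw inside by (auto simp: part_def)
    ultimately show "card (part ?T i) = 1"
      unfolding Ti using cvw by (subst card_Diff_subset) auto
  qed
  have Tk: "part ?T k = part S k - {w}"
    using inside k by (auto simp: part_def)
  have same: "part ?T j = part S j" if "j \<noteq> i" "j \<noteq> k" for j
    using inside that by (auto simp: part_def k_def)
  have mono: "card (part ?T j) \<le> card (part S j)" for j
    by (intro card_mono finite_part SV part_mono) auto
  have adjacent: "i = Suc k \<or> k = Suc i"
    using block_step[of v w] block_step[of w v] cvw(5) inside outside
    by (auto simp: k_def insert_commute)
  \<comment> \<open>Since \<open>k\<close> is a successor when it lies to the right, an untouched block \<open>k\<close> is single.\<close>
  have part_k: "card (part S k) \<le> 1 \<or>
      k = Suc i \<and> card (part S k) = 4 \<and> is_cherry G (part ?T k)"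
  proof (cases "i = Suc k")
    case True
    then show ?thesis using prev by blast
  next
    case False
    then have ki: "k = Suc i" using adjacent by simp
    then have "card (part S k) \<le> 1 \<or> part S k = part (verts G) k"
      using bal cards_i unfolding balanced_def by (metis numeral_le_one_iff semiring_norm(70))
    moreover have "single_block G (part (verts G) k)" if "part S k = part (verts G) k"
      using untouched_part[of k] k ki that by auto
    ultimately show ?thesis
      using k ki unfolding Tk single_block_def by metis
  qed
  show "balanced ?T"
    unfolding balanced_def
  proof (intro conjI allI)
    show "?T \<subseteq> verts G" using SV by auto
    fix j
    show "card (part ?T j) \<le> 1 \<or> part ?T j = part (verts G) j \<or>
          is_cherry G (part ?T j) \<and> (\<forall>l. j = Suc l \<longrightarrow> card (part ?T l) \<le> 1)"
    proof (cases "j = i \<or> j = k")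
      case True
      then show ?thesis
        using cards_i part_k mono[of k] by (auto intro: le_trans)
    next
      case False
      have "card (part S j) \<le> 1 \<or> part S j = part (verts G) j \<or>
          is_cherry G (part S j) \<and> (\<forall>l. j = Suc l \<longrightarrow> card (part S l) \<le> 1)"
        using bal unfolding balanced_def by blast
      moreover have "part ?T j = part S j"
        using False same by blast
      ultimately show ?thesis
        using mono le_trans by metis
    qed
  qed
  have "card (part ?T k) div 3 = card (part S k) div 3"
    using part_k
  proof
    assume "card (part S k) \<le> 1"
    then show ?thesis using mono[of k] by simp
  next
    assume "k = Suc i \<and> card (part S k) = 4 \<and> is_cherry G (part ?T k)"
    then show ?thesis using card_is_cherry by fastforce
  qed
  moreover have "i \<in> block ` verts G"
    using inside cvw SV by blast
  ultimately show "weight S = Suc (weight ?T)"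
    using cards_i same by (intro weight_drops[of i]) (simp, simp, metis)
qed

text \<open>
  The answer of the responder: stay inside the block of the center if possible. If it is not,
  the block is a path and the center one of its ends. Then one of the two neighbours
  offered by the given copy is the middle of the path, and the other lies in another block.
\<close>

lemma balanced_reply:
  assumes bal: "balanced S" and ch: "cherry G S a v b"
  shows "\<exists>a b. cherry G S a v b \<and> balanced (S - {a, v, b}) \<and> weight S = Suc (weight (S - {a, v, b}))"
proof -
  define i where "i = block v"
  let ?X = "part S i"
  have SV: "S \<subseteq> verts G"
    using bal by (simp add: balanced_def)
  have vX: "v \<in> ?X"
    using ch by (auto simp: cherry_def part_def i_def)
  have inS: "cherry G S a' v b'" if "cherry G ?X a' v b'" for a' b'
    using that by (rule cherry_mono) (rule part_subset)
  have not_both_outside: "a \<in> ?X \<or> b \<in> ?X"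
    using one_outside[of v a b] ch by (auto simp: cherry_def part_def i_def)
  consider (few) "card ?X \<le> 1" | (full) "?X = part (verts G) i"
    | (path) "is_cherry G ?X" "\<And>j. i = Suc j \<Longrightarrow> card (part S j) \<le> 1"
    using bal unfolding balanced_def by blast
  then show ?thesis
  proof cases
    case few
    \<comment> \<open>Both leaves would lie outside the block, where \<open>v\<close> has at most one neighbour.\<close>
    then have "?X = {v}"
      using vX finite_part[OF SV] by (auto simp: card_le_Suc0_iff_eq)
    then show ?thesis
      using not_both_outside ch by (auto simp: cherry_def)
  next
    case full
    then have "single_block G ?X \<or> i = 0 \<and> double_block G ?X"
      using untouched_part[of i] vX by force
    then obtain a' b' where ab: "cherry G ?X a' v b'"
      and "card ?X = 4 \<or> i = 0 \<and> is_cherry G (?X - {a', v, b'})"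
      unfolding single_block_def double_block_def using vX by metis
    moreover have "card (?X - {a', v, b'}) = card ?X - 3"
      using card_cherry[OF ab] ab card_Diff_subset[of "{a', v, b'}" ?X] by (simp add: cherry_def)
    ultimately have "balanced (S - {a', v, b'}) \<and> weight S = Suc (weight (S - {a', v, b'}))"
      by (intro reply_inside_block[OF bal ab]) auto
    then show ?thesis
      using inS[OF ab] by blast
  next
    case path
    show ?thesis
    proof (cases "\<exists>a' b'. cherry G ?X a' v b'")
      case True
      then obtain a' b' where ab: "cherry G ?X a' v b'" by blast
      have "card (?X - {a', v, b'}) = 0"
        using card_cherry[OF ab] ab card_Diff_subset[of "{a', v, b'}" ?X] card_is_cherry[OF path(1)]
        by (simp add: cherry_def)
      then have "balanced (S - {a', v, b'}) \<and> weight S = Suc (weight (S - {a', v, b'}))"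
        by (intro reply_inside_block[OF bal ab]) simp
      then show ?thesis
        using inS[OF ab] by blast
    next
      case False
      have "a \<notin> ?X \<or> b \<notin> ?X"
        using ch False vX unfolding cherry_def by blast
      then obtain w where w: "w \<in> S" "w \<notin> ?X" "{v, w} \<in> edges G"
        using ch unfolding cherry_def by blast
      obtain c where c: "c \<in> ?X" "c \<noteq> v" "{v, c} \<in> edges G"
        using not_both_outside ch by (auto simp: cherry_def)
      have cvw: "cherry G S c v w"
        using w c vX by (auto simp: cherry_def part_def)
      have "balanced (S - {c, v, w}) \<and> weight S = Suc (weight (S - {c, v, w}))"
        using w c vX by (intro reply_across_blocks[OF bal path cvw]) (auto simp: part_def)
      then show ?thesis
        using cvw by blast
    qed
  qed
qed

lemma balanced_weight_cherry:
  assumes bal: "balanced S" and "weight S \<noteq> 0"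
  shows "\<exists>a v b. cherry G S a v b"
proof -
  obtain i where i: "card (part S i) div 3 \<noteq> 0"
    using assms(2) unfolding weight_def by (meson sum.neutral)
  then have ge3: "card (part S i) \<ge> 3"
    by (simp add: div_eq_0_iff)
  then have "\<exists>a v b. cherry G (part S i) a v b"
  proof (cases "is_cherry G (part S i)")
    case True
    then show ?thesis by (auto simp: is_cherry_def)
  next
    case False
    moreover have "card (part S i) \<le> 1 \<or> part S i = part (verts G) i \<or> is_cherry G (part S i)"
      using bal unfolding balanced_def by blast
    ultimately have "part S i = part (verts G) i"
      using ge3 by linarith
    moreover have "part S i \<noteq> {}"
      using ge3 by auto
    ultimately show ?thesis
      using untouched_part[of i] unfolding single_block_def double_block_def by fastforce
  qed
  then show ?thesis
    using cherry_mono part_subset by metis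
qed

text \<open>
  Worth zero ends the game, since a further round would lower the worth; conversely positive
  worth guarantees that a round is still possible.
\<close>

lemma balanced_responder_forces:
  assumes "balanced S"
  shows "responder_forces G (weight S) S"
  using assms
proof (induction "weight S" arbitrary: S)
  case 0
  then have "\<not> cherry G S a v b" for a v b
    using balanced_reply[OF "0.prems", of a v b] by auto
  then show ?case
    unfolding \<open>0 = weight S\<close>[symmetric] by simp
next
  case (Suc n)
  have "\<exists>a v b. cherry G S a v b"
    using balanced_weight_cherry[OF Suc.prems] Suc.hyps(2) by simp
  moreover have "\<exists>a b. cherry G S a v b \<and> responder_forces G n (S - {a, v, b})"
    if "cherry G S a v b" for a v b
    using balanced_reply[OF Suc.prems that] Suc.hyps by (metis Suc_inject)
  ultimately show ?case
    unfolding Suc.hyps(2)[symmetric] by auto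
qed

lemma responder_forces_untouched: "responder_forces G (weight (verts G)) (verts G)"
  by (rule balanced_responder_forces) (simp add: balanced_def)

end


section \<open>The two strategies on the ladder\<close>

lemma verts_grid: "verts (grid n m) = {..<n} \<times> {..<m}"
  by (simp add: grid_def cartesian_product_def path_graph_def)

lemma verts_path_graph: "verts (path_graph n) = {..<n}"
  by (simp add: path_graph_def)

lemma edge_path_graph_iff:
  "{i, j} \<in> edges (path_graph n) \<longleftrightarrow> i < n \<and> j < n \<and> (j = Suc i \<or> i = Suc j)"
  by (auto simp: path_graph_def doubleton_eq_iff)

lemma edge_grid_2_iff:
  "{(x, i), (y, j)} \<in> edges (grid 2 m) \<longleftrightarrow>
     x < 2 \<and> y < 2 \<and> i < m \<and> j < m \<and>
     (x = y \<and> (j = Suc i \<or> i = Suc j) \<or> x \<noteq> y \<and> i = j)"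
proof -
  have "{(x, i), (y, j)} \<in> edges (grid 2 m) \<longleftrightarrow>
          x = y \<and> x < 2 \<and> {i, j} \<in> edges (path_graph m) \<or>
          i = j \<and> i < m \<and> {x, y} \<in> edges (path_graph 2)"
  proof -
    have row: "(\<exists>a p q. {(x, i), (y, j)} = {(a, p), (a, q)} \<and> a \<in> A \<and> {p, q} \<in> E) \<longleftrightarrow>
            x = y \<and> x \<in> A \<and> {i, j} \<in> E" for A and E :: "nat set set"
      by (auto simp: doubleton_eq_iff insert_commute)
    have column: "(\<exists>p q a. {(x, i), (y, j)} = {(p, a), (q, a)} \<and> {p, q} \<in> E \<and> a \<in> A) \<longleftrightarrow>
            i = j \<and> i \<in> A \<and> {x, y} \<in> E" for A and E :: "nat set set"
      by (auto simp: doubleton_eq_iff insert_commute)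
    show ?thesis
      unfolding grid_def cartesian_product_def verts_path_graph
      using row[of "{..<2}" "edges (path_graph m)"] column[of "edges (path_graph 2)" "{..<m}"]
      by simp
  qed
  also have "\<dots> \<longleftrightarrow> x < 2 \<and> y < 2 \<and> i < m \<and> j < m \<and>
     (x = y \<and> (j = Suc i \<or> i = Suc j) \<or> x \<noteq> y \<and> i = j)"
    unfolding edge_path_graph_iff by auto
  finally show ?thesis .
qed

lemma induced_subgraph_verts_grid: "induced_subgraph (grid n m) (verts (grid n m)) = grid n m"
proof -
  have "e \<subseteq> verts (grid n m)" if "e \<in> edges (grid n m)" for e
    using that unfolding verts_grid
    by (auto simp: grid_def cartesian_product_def path_graph_def doubleton_eq_iff)
  then have "{e \<in> edges (grid n m). e \<subseteq> verts (grid n m)} = edges (grid n m)"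
    by blast
  then show ?thesis
    by (simp add: induced_subgraph_def)
qed

text \<open>A center of degree two leaves the responder no choice.\<close>

lemma initiator_forces_only_cherry:
  assumes "v \<in> S" "p \<noteq> q" "p \<noteq> v" "q \<noteq> v"
    and nbrs: "\<And>w. w \<in> S \<and> {v, w} \<in> edges G \<longleftrightarrow> w = p \<or> w = q"
    and rest: "initiator_forces G n (S - {p, v, q})"
  shows "initiator_forces G (Suc n) S"
proof -
  have "cherry G S p v q"
    using assms(1-4) nbrs[of p] nbrs[of q] by (simp add: cherry_def)
  moreover have "initiator_forces G n (S - {a, v, b})" if "cherry G S a v b" for a b
  proof -
    have "a = p \<or> a = q" "b = p \<or> b = q" "a \<noteq> b"
      using that nbrs[of a] nbrs[of b] unfolding cherry_def by blast+
    then have "{a, v, b} = {p, v, q}" by blast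
    then show ?thesis using rest by simp
  qed
  ultimately show ?thesis
    unfolding initiator_forces.simps by blast
qed

text \<open>
  The position reached by the initiator after \<open>c/2\<close> rounds: columns from \<open>c\<close> on are full and
  each earlier pair of columns has left the row-1 vertex of its second column.
\<close>

definition combed_ladder :: "nat \<Rightarrow> nat \<Rightarrow> (nat \<times> nat) set" where
  "combed_ladder m c = {..<2} \<times> {c..<m} \<union> {1} \<times> {i. odd i \<and> i < c}"

lemma mem_combed_ladder:
  "(x, i) \<in> combed_ladder m c \<longleftrightarrow> x < 2 \<and> c \<le> i \<and> i < m \<or> x = 1 \<and> odd i \<and> i < c"
  by (auto simp: combed_ladder_def)

lemma no_cherry_odd_row:
  assumes "S \<subseteq> {1} \<times> {i. odd i}"
  shows "\<not> cherry (grid 2 m) S a v b"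
proof
  assume "cherry (grid 2 m) S a v b"
  then have "v \<in> {1} \<times> {i. odd i}" "a \<in> {1} \<times> {i. odd i}" "{v, a} \<in> edges (grid 2 m)"
    using assms unfolding cherry_def by blast+
  then obtain i j where "odd i" "odd j" "{(1, i), (1, j)} \<in> edges (grid 2 m)"
    by blast
  then show False
    unfolding edge_grid_2_iff by auto
qed

text \<open>
  The corner \<open>(0, c)\<close> has exactly two remaining neighbours because the left-over vertices
  are all in row 1. If \<open>c\<close> is the last column, the center is \<open>(1, c)\<close> instead, with leaves
  \<open>(0, c)\<close> and the left-over vertex in column \<open>c - 1\<close>; that vertex exists unless \<open>m = 1\<close>.
\<close>

lemma initiator_forces_combed_ladder:
  assumes "even c" "c \<le> m" "odd m \<Longrightarrow> 3 \<le> m"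
  shows "initiator_forces (grid 2 m) ((m - c + 1) div 2) (combed_ladder m c)"
  using assms
proof (induction "m - c" arbitrary: c rule: less_induct)
  case less
  consider "c = m" | "Suc c = m" | "Suc c < m"
    using less.prems by linarith
  then show ?case
  proof cases
    case 1
    have "combed_ladder m c \<subseteq> {1} \<times> {i. odd i}"
      using 1 by (auto simp: combed_ladder_def)
    then show ?thesis
      using 1 no_cherry_odd_row by simp
  next
    case 2
    then obtain i where i: "c = Suc i" "odd i" "m = Suc (Suc i)"
      using less.prems by (cases c) auto
    have "initiator_forces (grid 2 m) (Suc 0) (combed_ladder m c)"
    proof (rule initiator_forces_only_cherry[where v = "(1, c)" and p = "(0, c)" and q = "(1, i)"])
      show "w \<in> combed_ladder m c \<and> {(1, c), w} \<in> edges (grid 2 m) \<longleftrightarrow> w = (0, c) \<or> w = (1, i)" for w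
        using i by (cases w) (auto simp: mem_combed_ladder edge_grid_2_iff)
      have "combed_ladder m c - {(0, c), (1, c), (1, i)} \<subseteq> {1} \<times> {i. odd i}"
      proof (rule subrelI)
        fix x j assume "(x, j) \<in> combed_ladder m c - {(0, c), (1, c), (1, i)}"
        then have "x = 1 \<and> odd j"
          using 2 unfolding Diff_iff insert_iff empty_iff mem_combed_ladder prod.inject by linarith
        then show "(x, j) \<in> {1} \<times> {i. odd i}" by simp
      qed
      then show "initiator_forces (grid 2 m) 0 (combed_ladder m c - {(0, c), (1, c), (1, i)})"
        using no_cherry_odd_row by simp
    qed (use i in \<open>auto simp: mem_combed_ladder\<close>)
    moreover have "(m - c + 1) div 2 = Suc 0"
      using 2 by auto
    ultimately show ?thesis by metis
  next
    case 3
    have "initiator_forces (grid 2 m) (Suc ((m - (c + 2) + 1) div 2)) (combed_ladder m c)"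
    proof (rule initiator_forces_only_cherry
        [where v = "(0, c)" and p = "(1, c)" and q = "(0, Suc c)"])
      show "w \<in> combed_ladder m c \<and> {(0, c), w} \<in> edges (grid 2 m) \<longleftrightarrow> w = (1, c) \<or> w = (0, Suc c)"
        for w
        using 3 less.prems by (cases w) (auto simp: mem_combed_ladder edge_grid_2_iff)
      have "(x, i) \<in> combed_ladder m c - {(1, c), (0, c), (0, Suc c)} \<longleftrightarrow>
            (x, i) \<in> combed_ladder m (c + 2)" for x i
        using 3 \<open>even c\<close> unfolding Diff_iff insert_iff empty_iff mem_combed_ladder prod.inject
        by presburger
      then have "combed_ladder m c - {(1, c), (0, c), (0, Suc c)} = combed_ladder m (c + 2)"
        by (intro set_eqI) (metis surj_pair)
      then show "initiator_forces (grid 2 m) ((m - (c + 2) + 1) div 2)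
            (combed_ladder m c - {(1, c), (0, c), (0, Suc c)})"
        using 3 less.hyps[of "c + 2"] less.prems by simp
    qed (use 3 in \<open>auto simp: mem_combed_ladder\<close>)
    moreover have "Suc ((m - (c + 2) + 1) div 2) = (m - c + 1) div 2"
      using 3 by presburger
    ultimately show ?thesis by metis
  qed
qed

lemma initiator_forces_ladder:
  assumes "m \<ge> 2"
  shows "initiator_forces (grid 2 m) ((m + 1) div 2) (verts (grid 2 m))"
proof -
  have "combed_ladder m 0 = verts (grid 2 m)"
    by (auto simp: combed_ladder_def verts_grid)
  moreover have "odd m \<Longrightarrow> 3 \<le> m"
    using assms by presburger
  ultimately show ?thesis
    using initiator_forces_combed_ladder[of 0 m] by simp
qed

text \<open>
  Intended for \<open>2 * k + r\<close> columns with \<open>r < 2\<close>. For \<open>r = 1\<close> the truncated difference puts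
  column 0 together with columns 1 and 2 into block 0, which makes it the \<open>2 \<times> 3\<close> block.
\<close>

definition ladder_block :: "nat \<Rightarrow> nat \<times> nat \<Rightarrow> nat" where
  "ladder_block r = (\<lambda>(x, j). (j - r) div 2)"

lemma half_eq_iff: "n div 2 = i \<longleftrightarrow> 2 * i \<le> n \<and> n < 2 * i + 2" for n i :: nat
  by linarith

lemma ladder_block_square:
  assumes "i < k" "0 < i \<or> r = 0"
  shows "{v \<in> verts (grid 2 (2 * k + r)). ladder_block r v = i} =
           {..<2} \<times> {2 * i + r, 2 * i + r + 1}" (is "?B = ?S")
proof (rule set_eqI)
  fix v :: "nat \<times> nat"
  obtain x j where v: "v = (x, j)" by (cases v)
  have "j < 2 * k + r \<and> (j - r) div 2 = i \<longleftrightarrow> j = 2 * i + r \<or> j = 2 * i + r + 1"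
    unfolding half_eq_iff using assms by auto
  then show "v \<in> ?B \<longleftrightarrow> v \<in> ?S"
    unfolding v by (auto simp: verts_grid ladder_block_def)
qed

lemma ladder_block_domino:
  assumes "0 < k"
  shows "{v \<in> verts (grid 2 (2 * k + 1)). ladder_block 1 v = 0} = {..<2} \<times> {0, 1, 2}"
    (is "?B = ?S")
proof (rule set_eqI)
  fix v :: "nat \<times> nat"
  obtain x j where v: "v = (x, j)" by (cases v)
  have "j < 2 * k + 1 \<and> (j - 1) div 2 = 0 \<longleftrightarrow> j = 0 \<or> j = 1 \<or> j = 2"
    unfolding half_eq_iff using assms by auto
  then show "v \<in> ?B \<longleftrightarrow> v \<in> ?S"
    unfolding v by (auto simp: verts_grid ladder_block_def)
qed

lemma corner_is_cherry:
  assumes "x < 2" "y < 2" "x \<noteq> y" "i < m" "j < m" "j = Suc i \<or> i = Suc j"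
  shows "cherry (grid 2 m) {(y, i), (x, i), (x, j)} (y, i) (x, i) (x, j)"
  using assms by (auto simp: cherry_def edge_grid_2_iff)

text \<open>
  Writing the square from the point of view of \<open>v = (x, i)\<close>, with \<open>y\<close> the other row and \<open>j\<close>
  the other column, reduces everything to one case: \<open>v\<close> is a corner with leaves in both
  directions, and without \<open>v\<close> the opposite corner has this property.
\<close>

lemma single_block_square:
  assumes "Suc c < m"
  shows "single_block (grid 2 m) ({..<2} \<times> {c, c + 1})" (is "single_block ?G ?X")
proof -
  have corner: "(\<exists>a b. cherry ?G ?X a v b) \<and> is_cherry ?G (?X - {v})" if "v \<in> ?X" for v
  proof -
    obtain x i where v: "v = (x, i)" "x < 2" "i = c \<or> i = Suc c"
      using \<open>v \<in> ?X\<close> by auto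
    define y j where "y = 1 - x" and "j = 2 * c + 1 - i"
    have xy: "y < 2" "x \<noteq> y" "{..<2} = {x, y}"
      using v(2) by (auto simp: y_def less_2_cases_iff)
    have ij: "i < m" "j < m" "j = Suc i \<or> i = Suc j" "i \<noteq> j" "{c, c + 1} = {i, j}"
      using v(3) assms by (auto simp: j_def)
    have X: "?X = {(x, i), (x, j), (y, i), (y, j)}"
      unfolding xy(3) ij(5) by auto
    have "cherry ?G {(y, i), (x, i), (x, j)} (y, i) (x, i) (x, j)"
      by (rule corner_is_cherry) (use v xy ij in auto)
    then have "cherry ?G ?X (y, i) v (x, j)"
      unfolding v(1) unfolding X by (rule cherry_mono) blast
    moreover have "cherry ?G {(x, j), (y, j), (y, i)} (x, j) (y, j) (y, i)"
      by (rule corner_is_cherry) (use v xy ij in auto)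
    moreover have "?X - {v} = {(x, j), (y, j), (y, i)}"
      unfolding X v(1) using xy(2) ij(4) by auto
    ultimately show ?thesis
      unfolding is_cherry_def by metis
  qed
  then show ?thesis
    unfolding single_block_def by (auto simp: card_cartesian_product)
qed

text \<open>
  For a center in the middle column, taking its whole row leaves the other row. For a center
  \<open>(x, i)\<close> at an end, taking the corner there leaves a corner at the other end, column \<open>j\<close>.
  Taking such a corner-shaped copy at a middle center would instead leave three vertices that
  are not a path.
\<close>

lemma double_block_domino:
  assumes "3 \<le> m"
  shows "double_block (grid 2 m) ({..<2} \<times> {0, 1, 2})" (is "double_block ?G ?X")
proof -
  have "\<exists>a b. cherry ?G ?X a v b \<and> is_cherry ?G (?X - {a, v, b})" if "v \<in> ?X" for v
  proof -
    obtain x i where v: "v = (x, i)" "x < 2" "i = 0 \<or> i = 1 \<or> i = 2"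
      using \<open>v \<in> ?X\<close> by auto
    define y where "y = 1 - x"
    have xy: "y < 2" "x \<noteq> y" "{..<2} = {x, y}"
      using v(2) by (auto simp: y_def less_2_cases_iff)
    have X: "?X = {(x, 0), (x, 1), (x, 2), (y, 0), (y, 1), (y, 2)}"
      unfolding xy(3) by auto
    have row: "cherry ?G {(z, 0), (z, 1), (z, 2)} (z, 0) (z, 1) (z, 2)" if "z < 2" for z
      using that assms by (simp add: cherry_def edge_grid_2_iff)
    show ?thesis
    proof (cases "i = 1")
      case True
      have "cherry ?G ?X (x, 0) v (x, 2)"
        unfolding v(1) True X by (rule cherry_mono[OF row[OF v(2)]]) blast
      moreover have "?X - {(x, 0), v, (x, 2)} = {(y, 0), (y, 1), (y, 2)}"
        unfolding X v(1) True using xy(2) by auto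
      ultimately show ?thesis
        unfolding is_cherry_def using row[OF xy(1)] by metis
    next
      case False
      define j where "j = 2 - i"
      have ij: "i < m" "j < m" "i \<noteq> j" "i \<noteq> 1" "j \<noteq> 1" "Suc 0 = Suc i \<or> i = Suc 1" "Suc 0 = Suc j \<or> j = Suc 1"
        using v(3) False assms by (auto simp: j_def)
      have X': "?X = {(x, i), (x, 1), (x, j), (y, i), (y, 1), (y, j)}"
        unfolding X using v(3) False by (auto simp: j_def)
      have "cherry ?G {(y, i), (x, i), (x, 1)} (y, i) (x, i) (x, 1)"
        by (rule corner_is_cherry) (use v xy ij assms in auto)
      then have "cherry ?G ?X (y, i) v (x, 1)"
        unfolding v(1) unfolding X' by (rule cherry_mono) blast
      moreover have "?X - {(y, i), v, (x, 1)} = {(x, j), (y, j), (y, 1)}"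
        unfolding X' v(1) using xy(2) ij by auto
      moreover have "cherry ?G {(x, j), (y, j), (y, 1)} (x, j) (y, j) (y, 1)"
        by (rule corner_is_cherry) (use v xy ij assms in auto)
      ultimately show ?thesis
        unfolding is_cherry_def by metis
    qed
  qed
  then show ?thesis
    unfolding double_block_def by (auto simp: card_cartesian_product)
qed

text \<open>
  Adjacent columns are in the same or in consecutive blocks. As each block has at least two
  columns, the column of a vertex cannot have different blocks on both sides.
\<close>

lemma block_chain_ladder:
  assumes "0 < k" "r < 2"
  shows "block_chain (grid 2 (2 * k + r)) (ladder_block r)" (is "block_chain ?G _")
proof
  show "finite (verts ?G)"
    by (simp add: verts_grid)
  show "ladder_block r a \<le> Suc (ladder_block r v)" if "{v, a} \<in> edges ?G" for v a
  proof -
    obtain x i y j where v: "v = (x, i)" "a = (y, j)"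
      by (cases v; cases a) blast
    have "j \<le> Suc i"
      using that unfolding v edge_grid_2_iff by auto
    then have "(j - r) div 2 \<le> Suc ((i - r) div 2)"
      by linarith
    then show ?thesis
      by (simp add: v ladder_block_def)
  qed
  show "a = b"
    if "{v, a} \<in> edges ?G" "{v, b} \<in> edges ?G"
      "ladder_block r a \<noteq> ladder_block r v" "ladder_block r b \<noteq> ladder_block r v" for v a b
  proof -
    obtain x i y j z l where v: "v = (x, i)" "a = (y, j)" "b = (z, l)"
      by (cases v; cases a; cases b) blast
    have ne: "(j - r) div 2 \<noteq> (i - r) div 2" "(l - r) div 2 \<noteq> (i - r) div 2"
      using that(3,4) by (auto simp: v ladder_block_def)
    then have "j \<noteq> i" "l \<noteq> i" by auto
    then have "y = x" "z = x" "j = Suc i \<or> i = Suc j" "l = Suc i \<or> i = Suc l"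
      using that(1,2) unfolding v edge_grid_2_iff by auto
    moreover from this(3,4) ne have "j = l"
      by linarith
    ultimately show ?thesis by (simp add: v)
  qed
  fix i assume "i \<in> ladder_block r ` verts ?G"
  then obtain j where "j < 2 * k + r" "i = (j - r) div 2"
    by (auto simp: ladder_block_def verts_grid)
  then have i: "i < k"
    using assms by linarith
  show "single_block ?G {v \<in> verts ?G. ladder_block r v = i} \<or>
      i = 0 \<and> double_block ?G {v \<in> verts ?G. ladder_block r v = i}"
  proof (cases "0 < i \<or> r = 0")
    case True
    show ?thesis
      unfolding ladder_block_square[OF i True] using i by (intro disjI1 single_block_square) simp
  next
    case False
    then have "r = 1" "i = 0" using assms by auto
    then show ?thesis
      using double_block_domino[of "2 * k + 1"] ladder_block_domino[OF \<open>0 < k\<close>] \<open>0 < k\<close> by simp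
  qed
qed

lemma responder_forces_ladder:
  assumes "0 < k" "r < 2"
  shows "responder_forces (grid 2 (2 * k + r)) (k + r) (verts (grid 2 (2 * k + r)))"
    (is "responder_forces ?G _ _")
proof -
  interpret block_chain ?G "ladder_block r"
    by (rule block_chain_ladder[OF assms])
  have card: "card (part (verts ?G) i) div 3 = 1 + (if i = 0 then r else 0)" if i: "i < k" for i
  proof (cases "0 < i \<or> r = 0")
    case True
    then show ?thesis
      unfolding part_def ladder_block_square[OF i True] by auto
  next
    case False
    then have "r = 1" "i = 0" using assms by auto
    then show ?thesis
      unfolding part_def using ladder_block_domino[OF \<open>0 < k\<close>] by simp
  qed
  have "ladder_block r ` verts ?G = {..<k}"
  proof
    show "ladder_block r ` verts ?G \<subseteq> {..<k}"
      using assms by (auto simp: ladder_block_def verts_grid)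
    show "{..<k} \<subseteq> ladder_block r ` verts ?G"
    proof
      fix i assume "i \<in> {..<k}"
      then have "(0, 2 * i + r) \<in> verts ?G" "i = ladder_block r (0, 2 * i + r)"
        by (auto simp: ladder_block_def verts_grid)
      then show "i \<in> ladder_block r ` verts ?G" by blast
    qed
  qed
  then have "weight (verts ?G) = (\<Sum>i<k. 1 + (if i = 0 then r else 0))"
    unfolding weight_def using card by simp
  also have "\<dots> = k + r"
    unfolding sum.distrib using assms by simp
  finally show ?thesis
    using responder_forces_untouched by simp
qed

theorem lemma13:
  fixes m :: nat
  assumes "m \<ge> 2"
  shows "int (star_game_value Maximizer (grid 2 m)) = \<lceil>real m / 2\<rceil>
       \<and> int (star_game_value Minimizer (grid 2 m)) = \<lceil>real m / 2\<rceil>"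
proof -
  define k r where "k = m div 2" and "r = m mod 2"
  have m: "m = 2 * k + r" "r < 2" "0 < k"
    using assms by (auto simp: k_def r_def)
  have half: "(m + 1) div 2 = k + r"
    using m by auto
  have "star_game_value p (grid 2 m) = k + r" for p
  proof -
    have "finite (verts (grid 2 m))"
      by (simp add: verts_grid)
    moreover have "initiator_forces (grid 2 m) (k + r) (verts (grid 2 m))"
      using initiator_forces_ladder[OF assms] half by simp
    moreover have "responder_forces (grid 2 m) (k + r) (verts (grid 2 m))"
      using responder_forces_ladder[OF m(3,2)] m(1) by simp
    ultimately show ?thesis
      using star_game_value_forced induced_subgraph_verts_grid by metis
  qed
  moreover have "\<lceil>real m / 2\<rceil> = int (k + r)"
    using m by (intro ceiling_unique) auto
  ultimately show ?thesis by simp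
qed

end
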